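(* Let $s=\sigma+it$ with $\sigma>0$, and let $u_0$ and $v_0$ be any integers satisfying $v_0\ge u_0\ge 2\max\{6,\sqrt{\mathfrak{q}(s)},\sigma\}$. Then for any integers $M\ge v_0$ and $m\ge 0$ we have $$\zeta(s)=\sum_{n=1}^{v_0-1}\frac{1}{n^s}+\sum_{r=0}^{R}\frac{B_r(s,m)}{v_r^s}+\frac{M^{-s}}{2}+\frac{M^{1-s}}{s-1}+\mathcal{T}_{M,m}(s,u_0,v_0)+\mathcal{R}_M(s),$$ where $|\mathcal{T}_{M,m}(s,u_0,v_0)|\le \epsilon_m(s,u_0)\,\mathcal{B}_M(s,u_0,v_0)$. Moreover $R<2u_0\log(M/v_0)+1$.
   Context: $\zeta$ is the Riemann zeta function (analytically continued), and $\mathfrak{q}(s):=|s|+3$. For integers $M\ge 1$ and $\sigma>0$, $\mathcal{R}_M(s)$ is defined by $\zeta(s)=\sum_{1\le n<M}n^{-s}+\frac{M^{-s}}{2}+\frac{M^{1-s}}{s-1}+\mathcal{R}_M(s)$; $\mathcal{T}_{M,m}(s,u_0,v_0)$ is defined by the displayed identity in the claim (i.e. as the difference of the two sides without it). Let $f_s(z):=e^{sz}/(1+z)^s=e^{sz-s\log(1+z)}$ for $|z|<1$ (principal branch, so $f_s(0)=1$), and $g_K(z):=\sum_{k=0}^{K-1}e^{kz}$ ($=\frac{e^{Kz}-1}{e^z-1}$ for $z\notin 2\pi i\mathbb{Z}$); $f_s^{(j)}$, $g_K^{(j)}$ denote $j$-th derivatives in $z$. Given integers $u_0\ge1$, $v_0\ge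 u_0$, $M\ge v_0$: set $K_r=\lceil v_r/u_0\rceil$ and $v_{r+1}=v_r+K_r$; let $R$ be the largest integer such that $v_R<M$ (so the recursion is used for $0\le r<R$), and set $K_R:=\min\{\lceil v_R/u_0\rceil,M-v_R\}$, so that $v_R+K_R=M$. Define $$B_r(s,m):=\sum_{j=0}^m\frac{f_s^{(j)}(0)}{j!}\cdot\frac{g_{K_r}^{(j)}(-s/v_r)}{v_r^j},$$ $$\mathcal{B}_M(s,u_0,v_0):=\sum_{r=0}^R v_r^{-\sigma}\min\{g_{K_r}(-\sigma/v_r),\,|\csc(t/(2v_r))|\},$$ and $$\epsilon_m(s,u):=\begin{cases}\dfrac{3.5\,e^{0.78(m+1)}}{(m+1)^{(m+1)/2}}\dfrac{|s|^{(m+1)/2}}{u^{m+1}}, & m\le |s|/4,\\[2mm] \dfrac{2^m e^{0.194|s|}}{u^m}, & m>|s|/4.\end{cases}$$ *)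

theory Defs
  imports "HOL-Complex_Analysis.Complex_Analysis"
begin

text \<open>
  Existence of the analytic continuation of the Dirichlet series to \<open>\<complex> - {1}\<close>, so that the
  choice operator in the definition of \<open>zeta\<close> below picks a genuine witness. For \<open>Re s > 1\<close>,
  expanding \<open>(n + 1) powr (1 - s)\<close> at \<open>n\<close> and telescoping expresses \<open>(s - 1) * zeta s\<close> through
  the values \<open>zeta (s + k)\<close>, \<open>k \<ge> 1\<close>, which extends it one unit to the left at a time.
\<close>

lemma gbinomial_Suc_rec:
  fixes a :: "'a :: field_char_0"
  shows "a gchoose Suc k = (a gchoose k) * (a - of_nat k) / of_nat (Suc k)"
  using gbinomial_mult_1'[of a k] by (simp add: field_simps del: of_nat_Suc)

lemma norm_gbinomial_le:
  fixes a :: complex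
  assumes "cmod a \<le> A"
  shows "cmod (a gchoose k) \<le> (-1) ^ k * ((- A) gchoose k)"
proof (induction k)
  case (Suc k)
  have "cmod (a gchoose Suc k) = cmod (a gchoose k) * (cmod (a - of_nat k) / real (Suc k))"
    by (simp add: gbinomial_Suc_rec norm_mult norm_divide del: of_nat_Suc)
  also have "cmod (a - of_nat k) \<le> A + real k"
    using norm_triangle_ineq4[of a "of_nat k"] assms by simp
  also have "cmod (a gchoose k) * ((A + real k) / real (Suc k))
               \<le> ((-1) ^ k * ((- A) gchoose k)) * ((A + real k) / real (Suc k))"
    using order_trans[OF norm_ge_zero assms] by (intro mult_right_mono Suc) (auto intro!: divide_nonneg_nonneg)
  also have "\<dots> = (-1) ^ Suc k * ((- A) gchoose Suc k)"
    by (simp add: gbinomial_Suc_rec field_simps del: of_nat_Suc)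
  finally show ?case by (simp add: divide_right_mono mult_left_mono)
qed simp

lemma gbinomial_tail_le:
  fixes a z :: complex
  assumes a: "cmod a \<le> A" and z: "cmod z \<le> 1 / 2"
  shows "cmod ((1 + z) powr a - (\<Sum>k\<le>L. (a gchoose k) * z ^ k)) \<le> 2 powr A * (2 * cmod z) ^ Suc L"
proof -
  define c where "c k = (-1) ^ k * ((- A) gchoose k) * (1 / 2) ^ k" for k
  have "(\<lambda>k. ((- A) gchoose k) * (- 1 / 2) ^ k) sums (1 + (- 1 / 2)) powr (- A)"
    by (rule gen_binomial_real) simp
  also have "(\<lambda>k. ((- A) gchoose k) * (- 1 / 2) ^ k) = c"
    by (auto simp: c_def power_divide power_minus[of "1/2"])
  also have "(1 + (- 1 / 2)) powr (- A) = 2 powr A"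
    by (simp add: powr_minus powr_divide)
  finally have c: "c sums (2 powr A)" .
  have c_nonneg: "c k \<ge> 0" for k
    unfolding c_def using order_trans[OF norm_ge_zero norm_gbinomial_le[OF a, of k]]
    by (intro mult_nonneg_nonneg[of "(-1) ^ k * ((- A) gchoose k)"]) auto
  have csum: "summable c" using c by (simp add: sums_iff)
  have S: "(\<lambda>k. (a gchoose k) * z ^ k) sums (1 + z) powr a"
    using z by (intro gen_binomial_complex) simp
  have S': "(\<lambda>k. (a gchoose (k + Suc L)) * z ^ (k + Suc L)) sums
               ((1 + z) powr a - (\<Sum>k<Suc L. (a gchoose k) * z ^ k))"
    using sums_split_initial_segment[OF S, of "Suc L"] .
  have le: "cmod ((a gchoose (k + Suc L)) * z ^ (k + Suc L)) \<le> (2 * cmod z) ^ Suc L * c (k + Suc L)" for k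
  proof -
    have "cmod ((a gchoose (k + Suc L)) * z ^ (k + Suc L)) =
            cmod (a gchoose (k + Suc L)) * cmod z ^ (k + Suc L)"
      by (simp add: norm_mult norm_power)
    also have "\<dots> \<le> ((-1) ^ (k + Suc L) * ((- A) gchoose (k + Suc L))) * cmod z ^ (k + Suc L)"
      by (intro mult_right_mono norm_gbinomial_le a) auto
    also have "\<dots> = c (k + Suc L) * (2 * cmod z) ^ (k + Suc L)"
      by (simp add: c_def power_mult_distrib power_divide)
    also have "\<dots> \<le> c (k + Suc L) * (2 * cmod z) ^ Suc L"
      using z by (intro mult_left_mono power_decreasing c_nonneg) auto
    finally show ?thesis by (simp add: mult.commute)
  qed
  have csum': "summable (\<lambda>k. (2 * cmod z) ^ Suc L * c (k + Suc L))"
    by (intro summable_mult summable_ignore_initial_segment csum)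
  have "cmod ((1 + z) powr a - (\<Sum>k<Suc L. (a gchoose k) * z ^ k)) \<le> (\<Sum>k. (2 * cmod z) ^ Suc L * c (k + Suc L))"
    by (rule norm_sums_le[OF S' summable_sums[OF csum'] le])
  also have "\<dots> = (2 * cmod z) ^ Suc L * (\<Sum>k. c (k + Suc L))"
    by (intro suminf_mult summable_ignore_initial_segment csum)
  also have "\<dots> \<le> (2 * cmod z) ^ Suc L * 2 powr A"
  proof (rule mult_left_mono)
    show "(\<Sum>k. c (k + Suc L)) \<le> 2 powr A"
      using c suminf_minus_initial_segment[OF csum, of "Suc L"] sum_nonneg[of "{..<Suc L}" c, OF c_nonneg]
      unfolding sums_iff by linarith
  qed simp
  finally show ?thesis
    by (simp only: lessThan_Suc_atMost mult.commute)
qed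

lemma holomorphic_series:
  fixes f :: "nat \<Rightarrow> complex \<Rightarrow> complex"
  assumes S: "open S" and hol: "\<And>n. f n holomorphic_on S"
    and bd: "\<And>x. x \<in> S \<Longrightarrow> \<exists>d C c. 0 < d \<and> 0 \<le> C \<and> 1 < c \<and>
               (\<forall>\<^sub>F n in sequentially. \<forall>y\<in>ball x d. cmod (f n y) \<le> C * real (Suc n) powr (- c))"
  obtains g where "g holomorphic_on S" "\<And>x. x \<in> S \<Longrightarrow> (\<lambda>n. f n x) sums g x"
proof -
  have "\<exists>g. \<forall>x\<in>S. ((\<lambda>n. f n x) sums g x) \<and> g field_differentiable (at x)"
  proof (rule series_differentiable_comparison_complex[OF S])
    show "f n field_differentiable at x" if "x \<in> S" for n x
      using hol S that holomorphic_on_imp_differentiable_at by blast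
  next
    fix x assume "x \<in> S"
    from bd[OF this] obtain d C c where dC: "0 < d" "0 \<le> C" "1 < c"
      and ev: "\<forall>\<^sub>F n in sequentially. \<forall>y\<in>ball x d. cmod (f n y) \<le> C * real (Suc n) powr (- c)"
      by blast
    have "summable (\<lambda>n. C * real (Suc n) powr (- c))"
      using dC by (intro summable_mult, subst summable_Suc_iff) (simp add: summable_real_powr_iff)
    hence "summable (\<lambda>n. complex_of_real (C * real (Suc n) powr (- c)))"
      by (subst summable_of_real_iff)
    moreover have "\<forall>\<^sub>F n in sequentially. \<forall>y\<in>ball x d \<inter> S.
        cmod (f n y) \<le> cmod (complex_of_real (C * real (Suc n) powr (- c)))"
      using ev by eventually_elim (use dC in \<open>auto simp: norm_mult\<close>)
    ultimately show "\<exists>d h. 0 < d \<and> summable h \<and> range h \<subseteq> \<real>\<^sub>\<ge>\<^sub>0 \<and>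
        (\<forall>\<^sub>F n in sequentially. \<forall>y\<in>ball x d \<inter> S. cmod (f n y) \<le> cmod (h n))"
      using dC by (intro exI[of _ d] exI[of _ "\<lambda>n. complex_of_real (C * real (Suc n) powr (- c))"])
                  (auto simp del: of_real_mult)
  qed blast
  then obtain g where g: "\<And>x. x \<in> S \<Longrightarrow> (\<lambda>n. f n x) sums g x \<and> g field_differentiable (at x)"
    by blast
  show ?thesis
    by (rule that[of g])
       (use g in \<open>auto simp: holomorphic_on_def intro: field_differentiable_at_within\<close>)
qed

lemma norm_of_nat_powr: "cmod (of_nat (Suc n) powr s) = real (Suc n) powr Re s"
  by (subst norm_powr_real_powr) auto

lemma Re_ball: "y \<in> ball x d \<Longrightarrow> Re x - d < Re y"
  using abs_Re_le_cmod[of "x - y"] by (auto simp: dist_norm)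

definition zeta_tail :: "nat \<Rightarrow> nat \<Rightarrow> complex \<Rightarrow> complex" where
  "zeta_tail L n s = of_nat (Suc (Suc n)) powr (1 - s)
     - (\<Sum>k\<le>L. ((1 - s) gchoose k) * of_nat (Suc n) powr (1 - s - of_nat k))"

lemma holomorphic_gbinomial [holomorphic_intros]:
  "f holomorphic_on S \<Longrightarrow> (\<lambda>s. f s gchoose k) holomorphic_on S"
  unfolding gbinomial_prod_rev by (auto intro!: holomorphic_intros)

lemma zeta_tail_holomorphic: "zeta_tail L n holomorphic_on S"
  unfolding zeta_tail_def[abs_def] by (intro holomorphic_intros)

lemma norm_zeta_tail_le:
  assumes n: "n \<ge> 1" and A: "cmod (1 - s) \<le> A"
  shows "cmod (zeta_tail L n s) \<le> 2 powr A * 2 ^ Suc L * real (Suc n) powr (- Re s - real L)"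
proof -
  define z :: complex where "z = 1 / of_nat (Suc n)"
  define N :: complex where "N = of_nat (Suc n)"
  have N0: "N \<noteq> 0" by (simp add: N_def del: of_nat_Suc)
  have nz: "cmod z = 1 / real (Suc n)" by (simp add: z_def norm_divide del: of_nat_Suc)
  have z2: "cmod z \<le> 1 / 2" using n by (simp add: nz field_simps)
  have "of_nat (Suc (Suc n)) = N * (1 + z)"
    using N0 by (simp add: z_def N_def field_simps)
  hence "of_nat (Suc (Suc n)) powr (1 - s) = (N * (1 + z)) powr (1 - s)" by simp
  also have "\<dots> = N powr (1 - s) * (1 + z) powr (1 - s)"
    by (rule powr_times_real) (auto simp: N_def z_def simp flip: of_nat_Suc)
  finally have 1: "of_nat (Suc (Suc n)) powr (1 - s) = N powr (1 - s) * (1 + z) powr (1 - s)" .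
  have 2: "N powr (1 - s - of_nat k) = N powr (1 - s) * z ^ k" for k
    using N0 by (simp add: powr_diff z_def N_def power_divide)
  have "zeta_tail L n s = N powr (1 - s) * ((1 + z) powr (1 - s) - (\<Sum>k\<le>L. ((1 - s) gchoose k) * z ^ k))"
    unfolding zeta_tail_def 1 N_def[symmetric] 2 by (simp add: algebra_simps sum_distrib_left)
  also have "cmod \<dots> \<le> real (Suc n) powr Re (1 - s) * (2 powr A * (2 * cmod z) ^ Suc L)"
    unfolding norm_mult N_def norm_of_nat_powr by (intro mult_left_mono gbinomial_tail_le A z2) auto
  also have "(2 * cmod z) ^ Suc L = 2 ^ Suc L * real (Suc n) powr (- real (Suc L))"
    unfolding nz by (simp add: powr_minus powr_realpow power_divide divide_inverse power_mult_distrib power_inverse del: of_nat_Suc power_Suc)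
  also have "real (Suc n) powr Re (1 - s) * (2 powr A * (2 ^ Suc L * real (Suc n) powr (- real (Suc L)))) =
      2 powr A * 2 ^ Suc L * (real (Suc n) powr Re (1 - s) * real (Suc n) powr (- real (Suc L)))"
    by (simp only: mult_ac)
  also have "real (Suc n) powr Re (1 - s) * real (Suc n) powr (- real (Suc L)) = real (Suc n) powr (- Re s - real L)"
    by (subst powr_add[symmetric]) (simp add: algebra_simps)
  finally show ?thesis .
qed

lemma telescope_powr:
  assumes "Re s > 1"
  shows "(\<lambda>n. of_nat (Suc n) powr (1 - s) - of_nat (Suc (Suc n)) powr (1 - s)) sums 1"
proof -
  have "(\<lambda>n. real (Suc n) powr (1 - Re s)) \<longlonglongrightarrow> 0"
    using assms by (intro tendsto_neg_powr filterlim_compose[OF filterlim_real_sequentially filterlim_Suc]) auto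
  hence "(\<lambda>n. cmod (of_nat (Suc n) powr (1 - s))) \<longlonglongrightarrow> 0"
    unfolding norm_of_nat_powr by simp
  hence "(\<lambda>n. of_nat (Suc n) powr (1 - s)) \<longlonglongrightarrow> (0::complex)"
    by (rule tendsto_norm_zero_cancel)
  from telescope_sums'[OF this] show ?thesis by simp
qed

lemma open_Re_gt: "open {s. Re s > c}"
  by (intro open_Collect_less continuous_intros)

lemma zeta_half_plane:
  "\<exists>F. F holomorphic_on {s. Re s > 1 - real N} \<and>
       (\<forall>s. Re s > 1 \<longrightarrow> (\<lambda>n. (s - 1) * of_nat (Suc n) powr (- s)) sums F s)"
proof (induction N)
  case 0
  obtain g where g: "g holomorphic_on {s. Re s > 1}"
    "\<And>s. s \<in> {s. Re s > 1} \<Longrightarrow> (\<lambda>n. (s - 1) * of_nat (Suc n) powr (- s)) sums g s"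
  proof (rule holomorphic_series[of "{s. Re s > 1}" "\<lambda>n s. (s - 1) * of_nat (Suc n) powr (- s)"])
    show "open {s. Re s > 1}" by (rule open_Re_gt)
    show "(\<lambda>s. (s - 1) * of_nat (Suc n) powr (- s)) holomorphic_on {s. Re s > 1}" for n
      by (intro holomorphic_intros)
    fix x assume "x \<in> {s. Re s > 1}"
    define d where "d = (Re x - 1) / 2"
    have d: "d > 0" "Re x - d > 1" using \<open>x \<in> _\<close> by (auto simp: d_def field_simps)
    have "cmod ((y - 1) * of_nat (Suc n) powr (- y)) \<le> (cmod (x - 1) + d) * real (Suc n) powr (- (Re x - d))"
      if y: "y \<in> ball x d" for y n
    proof -
      have "cmod (y - 1) \<le> cmod (x - 1) + d"
        using y norm_triangle_ineq[of "x - 1" "y - x"] by (auto simp: dist_norm norm_minus_commute)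
      moreover have "real (Suc n) powr Re (- y) \<le> real (Suc n) powr (- (Re x - d))"
        using Re_ball[OF y] by (intro powr_mono) auto
      ultimately show ?thesis
        unfolding norm_mult norm_of_nat_powr using d by (intro mult_mono) auto
    qed
    thus "\<exists>d C c. 0 < d \<and> 0 \<le> C \<and> 1 < c \<and> (\<forall>\<^sub>F n in sequentially. \<forall>y\<in>ball x d.
             cmod ((y - 1) * of_nat (Suc n) powr (- y)) \<le> C * real (Suc n) powr (- c))"
      using d by (intro exI[of _ d] exI[of _ "cmod (x - 1) + d"] exI[of _ "Re x - d"]) auto
  qed auto
  thus ?case by auto
next
  case (Suc N)
  then obtain F where F: "F holomorphic_on {s. Re s > 1 - real N}"
    and F_sums: "\<And>s. Re s > 1 \<Longrightarrow> (\<lambda>n. (s - 1) * of_nat (Suc n) powr (- s)) sums F s"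
    by blast
  define S where "S = {s. Re s > 1 - real (Suc N)}"
  define L where "L = Suc N"
  obtain g where g: "g holomorphic_on S" "\<And>s. s \<in> S \<Longrightarrow> (\<lambda>n. zeta_tail L n s) sums g s"
  proof (rule holomorphic_series[of S "zeta_tail L"])
    show "open S" unfolding S_def by (rule open_Re_gt)
    show "zeta_tail L n holomorphic_on S" for n by (rule zeta_tail_holomorphic)
    fix x assume "x \<in> S"
    define d where "d = (Re x + real N) / 2"
    have d: "d > 0" "Re x - d + real L > 1" using \<open>x \<in> _\<close> by (auto simp: d_def S_def L_def field_simps)
    define A where "A = cmod (1 - x) + d"
    have "cmod (zeta_tail L n y) \<le> (2 powr A * 2 ^ Suc L) * real (Suc n) powr (- (Re x - d + real L))"
      if y: "y \<in> ball x d" and n: "n \<ge> 1" for y n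
    proof -
      have "cmod (1 - y) \<le> A"
        using y norm_triangle_ineq[of "1 - x" "x - y"] by (auto simp: dist_norm A_def)
      hence "cmod (zeta_tail L n y) \<le> 2 powr A * 2 ^ Suc L * real (Suc n) powr (- Re y - real L)"
        by (intro norm_zeta_tail_le n)
      also have "\<dots> \<le> 2 powr A * 2 ^ Suc L * real (Suc n) powr (- (Re x - d + real L))"
        using Re_ball[OF y] by (intro mult_left_mono powr_mono) auto
      finally show ?thesis .
    qed
    hence "\<forall>\<^sub>F n in sequentially. \<forall>y\<in>ball x d.
             cmod (zeta_tail L n y) \<le> (2 powr A * 2 ^ Suc L) * real (Suc n) powr (- (Re x - d + real L))"
      by (intro eventually_mono[OF eventually_ge_at_top[of 1]]) blast
    thus "\<exists>d C c. 0 < d \<and> 0 \<le> C \<and> 1 < c \<and> (\<forall>\<^sub>F n in sequentially. \<forall>y\<in>ball x d.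
             cmod (zeta_tail L n y) \<le> C * real (Suc n) powr (- c))"
      using d by (intro exI[of _ d] exI[of _ "2 powr A * 2 ^ Suc L"] exI[of _ "Re x - d + real L"]) auto
  qed auto
  define G where "G s = 1 - (\<Sum>k=2..L. ((1 - s) gchoose (k - 1)) / of_nat k * F (s + of_nat (k - 1))) + g s" for s
  have "G holomorphic_on S"
  proof -
    have "(\<lambda>s. F (s + of_nat (k - 1))) holomorphic_on S" if "k \<in> {2..L}" for k
    proof -
      have "(F \<circ> (\<lambda>s. s + of_nat (k - 1))) holomorphic_on S"
        using that by (intro holomorphic_on_compose_gen[OF _ F] holomorphic_intros)
          (auto simp: S_def of_nat_diff)
      thus ?thesis by (simp add: o_def)
    qed
    thus ?thesis unfolding G_def[abs_def] using g(1)
      by (intro holomorphic_intros) auto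
  qed
  moreover have "(\<lambda>n. (s - 1) * of_nat (Suc n) powr (- s)) sums G s" if s: "Re s > 1" for s
  proof -
    have eq: "(1 - s gchoose k) * of_nat (Suc n) powr (1 - s - of_nat k) =
       - ((1 - s gchoose (k - 1)) / of_nat k * ((s + of_nat (k - 1) - 1) * of_nat (Suc n) powr (- (s + of_nat (k - 1)))))"
      if k: "k \<in> {2..L}" for k n
    proof -
      obtain j where j: "k = Suc j" using k by (cases k) auto
      show ?thesis unfolding j gbinomial_Suc_rec
        by (simp add: algebra_simps divide_simps del: of_nat_Suc) (simp add: algebra_simps)
    qed
    have "(\<lambda>n. (of_nat (Suc n) powr (1 - s) - of_nat (Suc (Suc n)) powr (1 - s)) -
          (\<Sum>k=2..L. (1 - s gchoose (k - 1)) / of_nat k *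
             ((s + of_nat (k - 1) - 1) * of_nat (Suc n) powr (- (s + of_nat (k - 1))))) + zeta_tail L n s)
          sums G s"
      unfolding G_def using s
      by (intro sums_add sums_diff telescope_powr sums_sum sums_mult F_sums g) (auto simp: S_def)
    also have "(\<lambda>n. (of_nat (Suc n) powr (1 - s) - of_nat (Suc (Suc n)) powr (1 - s)) -
          (\<Sum>k=2..L. (1 - s gchoose (k - 1)) / of_nat k *
             ((s + of_nat (k - 1) - 1) * of_nat (Suc n) powr (- (s + of_nat (k - 1))))) + zeta_tail L n s) =
          (\<lambda>n. (s - 1) * of_nat (Suc n) powr (- s))" (is "?l = ?r")
    proof
      fix n
      have "(\<Sum>k\<le>L. (1 - s gchoose k) * of_nat (Suc n) powr (1 - s - of_nat k)) =
         of_nat (Suc n) powr (1 - s) + (1 - s) * of_nat (Suc n) powr (- s) +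
         (\<Sum>k=2..L. (1 - s gchoose k) * of_nat (Suc n) powr (1 - s - of_nat k))"
      proof -
        have "{..L} = insert 0 (insert 1 {2..L})" by (auto simp: L_def)
        thus ?thesis by simp
      qed
      also have "(\<Sum>k=2..L. (1 - s gchoose k) * of_nat (Suc n) powr (1 - s - of_nat k)) =
         - (\<Sum>k=2..L. (1 - s gchoose (k - 1)) / of_nat k *
             ((s + of_nat (k - 1) - 1) * of_nat (Suc n) powr (- (s + of_nat (k - 1)))))"
        unfolding sum_negf[symmetric] by (rule sum.cong[OF refl eq])
      finally show "?l n = ?r n" unfolding zeta_tail_def by (simp add: algebra_simps)
    qed
    finally show ?thesis .
  qed
  ultimately show ?case unfolding S_def by blast
qed

lemma zeta_exists:
  "\<exists>f. f holomorphic_on (- {1}) \<and>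
     (\<forall>s. Re s > 1 \<longrightarrow> (\<lambda>n. of_nat (Suc n) powr (- s)) sums f s)"
proof -
  from zeta_half_plane obtain F where
    F: "\<And>N. F N holomorphic_on {s. Re s > 1 - real N}" and
    sums: "\<And>N s. Re s > 1 \<Longrightarrow> (\<lambda>n. (s - 1) * of_nat (Suc n) powr (- s)) sums F N s"
    by metis
  define G where "G s = F (nat \<lceil>2 - Re s\<rceil>) s" for s
  have eq: "F M s = F N s" if "M \<le> N" "Re s > 1 - real M" for M N s
  proof (rule analytic_continuation_open[of "{s. Re s > 1}" "{s. Re s > 1 - real M}" "F M" "F N"])
    show "{s. Re s > 1} \<noteq> {}" by (auto intro: exI[of _ 2])
    show "connected {s. 1 - real M < Re s}"
      by (intro convex_connected convex_halfspace_Re_gt)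
    show "F N holomorphic_on {s. Re s > 1 - real M}"
      by (rule holomorphic_on_subset[OF F]) (use that in auto)
    show "F M z = F N z" if "z \<in> {s. Re s > 1}" for z
      using that sums[of z] sums_unique2 by blast
  qed (use that F open_Re_gt in auto)
  have GF: "G s = F N s" if "Re s > 1 - real N" for N s
  proof -
    have "Re s > 1 - real (nat \<lceil>2 - Re s\<rceil>)" by linarith
    thus ?thesis unfolding G_def using eq that by (metis nle_le)
  qed
  have "G holomorphic_on (\<Union>N. {s. Re s > 1 - real N})"
    by (intro holomorphic_on_UN_open open_Re_gt holomorphic_transform[OF F]) (auto simp: GF)
  also have "(\<Union>N. {s. Re s > 1 - real N}) = UNIV"
  proof -
    have "\<exists>N. Re s > 1 - real N" for s
      using reals_Archimedean2[of "1 - Re s"] by (auto simp: algebra_simps)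
    thus ?thesis by auto
  qed
  finally have G: "G holomorphic_on UNIV" .
  have "(\<lambda>s. G s / (s - 1)) holomorphic_on (- {1})"
    by (intro holomorphic_intros holomorphic_on_subset[OF G]) auto
  moreover have "(\<lambda>n. of_nat (Suc n) powr (- s)) sums (G s / (s - 1))" if "Re s > 1" for s
  proof -
    have "s \<noteq> 1" using that by auto
    moreover have "(\<lambda>n. (s - 1) * of_nat (Suc n) powr (- s)) sums G s"
      using sums[OF that, of 0] GF[of 0 s] that by simp
    ultimately show ?thesis
      using sums_divide[of "\<lambda>n. (s - 1) * of_nat (Suc n) powr (- s)" "G s" "s - 1"] by simp
  qed
  ultimately show ?thesis by blast
qed

text \<open>The value at the pole \<open>1\<close> is unspecified.\<close>
definition zeta :: "complex \<Rightarrow> complex" where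
  "zeta = (SOME f. f holomorphic_on (- {1}) \<and>
     (\<forall>s. Re s > 1 \<longrightarrow> (\<lambda>n. of_nat (Suc n) powr (- s)) sums f s))"

lemma zeta_holomorphic: "zeta holomorphic_on (- {1})"
  and zeta_sums: "Re s > 1 \<Longrightarrow> (\<lambda>n. of_nat (Suc n) powr (- s)) sums zeta s"
  using someI_ex[OF zeta_exists] unfolding zeta_def[symmetric] by blast+

lemma zeta_unique:
  assumes "f holomorphic_on (- {1})" "s \<noteq> 1"
    and "\<And>s. Re s > 1 \<Longrightarrow> (\<lambda>n. of_nat (Suc n) powr (- s)) sums f s"
  shows "f s = zeta s"
proof (rule analytic_continuation_open[of "{s. Re s > 1}" "- {1}" f zeta])
  show "{s. Re s > 1} \<noteq> {}" by (auto intro: exI[of _ 2])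
  show "connected (- {1 :: complex})"
    by (rule connected_punctured_universe) simp
  show "f z = zeta z" if "z \<in> {s. Re s > 1}" for z
    using that zeta_sums assms(3) sums_unique2 by blast
qed (use assms zeta_holomorphic open_Re_gt in auto)

definition conductor :: "complex \<Rightarrow> real" where
  "conductor s = cmod s + 3"

definition zeta_rem :: "nat \<Rightarrow> complex \<Rightarrow> complex" where
  "zeta_rem M s = zeta s - ((\<Sum>n = 1..<M. of_nat n powr (- s)) + of_nat M powr (- s) / 2
                        + of_nat M powr (1 - s) / (s - 1))"

definition f_fun :: "complex \<Rightarrow> complex \<Rightarrow> complex" where
  "f_fun s z = exp (s * z - s * Ln (1 + z))"

definition g_fun :: "nat \<Rightarrow> 'a :: {banach, real_normed_field} \<Rightarrow> 'a" where
  "g_fun K z = (\<Sum>k<K. exp (of_nat k * z))"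

definition block_len :: "nat \<Rightarrow> nat \<Rightarrow> nat" where
  "block_len u0 v = nat \<lceil>real v / real u0\<rceil>"

fun v_seq :: "nat \<Rightarrow> nat \<Rightarrow> nat \<Rightarrow> nat" where
  "v_seq u0 v0 0 = v0"
| "v_seq u0 v0 (Suc r) = v_seq u0 v0 r + block_len u0 (v_seq u0 v0 r)"

text \<open>
  \<open>R_max u0 v0 M\<close> is the largest index \<open>R\<close> with \<open>v_R < M\<close>.
  If \<open>M = v0\<close> then no index satisfies \<open>v_seq u0 v0 r < M\<close>; we then put \<open>R = 0\<close>, so that the
  single block has length \<open>min (block_len u0 v0) (M - v0) = 0\<close> and contributes nothing.
\<close>
definition R_max :: "nat \<Rightarrow> nat \<Rightarrow> nat \<Rightarrow> nat" where
  "R_max u0 v0 M = (if v0 < M then (GREATEST r. v_seq u0 v0 r < M) else 0)"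

definition K_seq :: "nat \<Rightarrow> nat \<Rightarrow> nat \<Rightarrow> nat \<Rightarrow> nat" where
  "K_seq u0 v0 M r =
     (if r < R_max u0 v0 M then block_len u0 (v_seq u0 v0 r)
      else min (block_len u0 (v_seq u0 v0 r)) (M - v_seq u0 v0 r))"

definition B_coeff :: "nat \<Rightarrow> nat \<Rightarrow> nat \<Rightarrow> nat \<Rightarrow> complex \<Rightarrow> nat \<Rightarrow> complex" where
  "B_coeff u0 v0 M r s m =
     (\<Sum>j\<le>m. (deriv ^^ j) (f_fun s) 0 / fact j *
        ((deriv ^^ j) (g_fun (K_seq u0 v0 M r)) (- s / of_nat (v_seq u0 v0 r)) / of_nat (v_seq u0 v0 r) ^ j))"

text \<open>
  \<open>min_csc a x\<close> is the minimum of \<open>a\<close> and \<open>\<bar>csc x\<bar>\<close>, where \<open>\<bar>csc x\<bar> = \<infinity>\<close> at the zeros of \<open>sin\<close>.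
\<close>
definition min_csc :: "real \<Rightarrow> real \<Rightarrow> real" where
  "min_csc a x = (if sin x = 0 then a else min a \<bar>1 / sin x\<bar>)"

definition B_bound :: "nat \<Rightarrow> complex \<Rightarrow> nat \<Rightarrow> nat \<Rightarrow> real" where
  "B_bound M s u0 v0 =
     (\<Sum>r\<le>R_max u0 v0 M. real (v_seq u0 v0 r) powr (- Re s) *
        min_csc (g_fun (K_seq u0 v0 M r) (- Re s / real (v_seq u0 v0 r)))
                (Im s / (2 * real (v_seq u0 v0 r))))"

definition eps_bound :: "nat \<Rightarrow> complex \<Rightarrow> real \<Rightarrow> real" where
  "eps_bound m s u =
     (if real m \<le> cmod s / 4
      then 3.5 * exp (0.78 * (real m + 1)) / (real m + 1) powr ((real m + 1) / 2)
             * (cmod s powr ((real m + 1) / 2) / u ^ (m + 1))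
      else 2 ^ m * exp (0.194 * cmod s) / u ^ m)"

definition T_rem :: "nat \<Rightarrow> nat \<Rightarrow> complex \<Rightarrow> nat \<Rightarrow> nat \<Rightarrow> complex" where
  "T_rem M m s u0 v0 = zeta s -
     ((\<Sum>n = 1..v0 - 1. 1 / of_nat n powr s)
      + (\<Sum>r\<le>R_max u0 v0 M. B_coeff u0 v0 M r s m / of_nat (v_seq u0 v0 r) powr s)
      + of_nat M powr (- s) / 2 + of_nat M powr (1 - s) / (s - 1) + zeta_rem M s)"

end

theory Submission
  imports Defs
begin

text \<open>
  Write \<open>f_s(z) = \<Sum> a\<^sub>j z\<^sup>j\<close>. A block starting at \<open>v\<close> equals
  \<open>v\<^bsup>-s\<^esup> \<Sum>\<^sub>k e\<^bsup>-sk/v\<^esup> f_s(k/v)\<close>, and truncating the Taylor series after degree \<open>m\<close> gives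
  the main term, so the error of a block is \<open>v\<^bsup>-s\<^esup> \<Sum>\<^sub>j\<^sub>>\<^sub>m a\<^sub>j P\<^sub>j\<close> with
  \<open>P\<^sub>j = \<Sum>\<^sub>k e\<^bsup>-sk/v\<^esup> (k/v)\<^sup>j\<close>. As \<open>(k/v)\<^sup>j\<close> is increasing in \<open>k\<close>, vanishes at \<open>k = 0\<close> and is at
  most \<open>u\<^sub>0\<^bsup>-j\<^esup>\<close>, Abel summation bounds \<open>P\<^sub>j\<close> by \<open>u\<^sub>0\<^bsup>-j\<^esup>\<close> times the minimum of the trivial bound and
  the cosecant, with no loss of constant.

  It remains to bound \<open>\<Sum>\<^sub>j\<^sub>>\<^sub>m |a\<^sub>j| u\<^sub>0\<^bsup>-j\<^esup>\<close>. The \<open>|a\<^sub>j|\<close> are majorised by the nonnegative coefficients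
  of \<open>exp (|s| (- z - ln (1 - z)))\<close>, and Rankin's trick at the radius \<open>1/2\<close>, or at
  \<open>sqrt ((m + 1) / |s|)\<close> when this is at most \<open>1/2\<close>, yields the two cases of \<open>eps_bound\<close>.
\<close>

subsection \<open>Taylor coefficients\<close>

definition f_coeff :: "complex \<Rightarrow> nat \<Rightarrow> complex" where
  "f_coeff s j = (deriv ^^ j) (f_fun s) 0 / fact j"

lemma one_plus_notin_nonpos_Reals:
  fixes z :: complex
  assumes "cmod z < 1"
  shows "1 + z \<notin> \<real>\<^sub>\<le>\<^sub>0"
  using assms abs_Re_le_cmod[of z] by (auto simp: complex_nonpos_Reals_iff)

lemma f_fun_holomorphic: "f_fun s holomorphic_on ball 0 1"
  unfolding f_fun_def[abs_def] by (intro holomorphic_intros one_plus_notin_nonpos_Reals) auto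

lemma f_fun_sums:
  assumes "cmod z < 1"
  shows "(\<lambda>j. f_coeff s j * z ^ j) sums f_fun s z"
  using holomorphic_power_series[OF f_fun_holomorphic[of s], of z] assms
  by (simp add: f_coeff_def)

text \<open>The logarithmic derivative is s - s / (1 + z) = s z / (1 + z); clearing the denominator
  leaves polynomial coefficients, hence a recurrence of finite length.\<close>

lemma deriv_f_fun:
  assumes "cmod z < 1"
  shows "(1 + z) * deriv (f_fun s) z = s * (z * f_fun s z)"
proof -
  have nz: "1 + z \<noteq> 0" using one_plus_notin_nonpos_Reals[OF assms] by force
  have "(f_fun s has_field_derivative f_fun s z * (s - s / (1 + z))) (at z)"
    unfolding f_fun_def[abs_def] using one_plus_notin_nonpos_Reals[OF assms]
    by (auto intro!: derivative_eq_intros simp: divide_inverse)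
  hence "deriv (f_fun s) z = f_fun s z * (s - s / (1 + z))" by (rule DERIV_imp_deriv)
  thus ?thesis using nz by (simp add: field_simps)
qed

lemma f_coeff_0: "f_coeff s 0 = 1"
  by (simp add: f_coeff_def f_fun_def)

lemma f_coeff_1: "f_coeff s (Suc 0) = 0"
  using deriv_f_fun[of 0 s] by (simp add: f_coeff_def)

text \<open>The differential equation \<open>(1 + z) f' = s z f\<close>, read off coefficientwise.\<close>
lemma f_coeff_rec:
  "of_nat (j + 2) * f_coeff s (j + 2) = s * f_coeff s j - of_nat (j + 1) * f_coeff s (j + 1)"
proof -
  define A where "A = fps_expansion (f_fun s) 0"
  have A: "f_fun s has_fps_expansion A"
    unfolding A_def using f_fun_holomorphic by (rule has_fps_expansion_fps_expansion[rotated 2]) auto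
  have nth: "fps_nth A n = f_coeff s n" for n
    using fps_nth_fps_expansion[OF A] by (simp add: f_coeff_def)
  have 1: "(\<lambda>z. (1 + z) * deriv (f_fun s) z) has_fps_expansion (1 + fps_X) * fps_deriv A"
    by (intro fps_expansion_intros A)
  have 2: "(\<lambda>z. s * (z * f_fun s z)) has_fps_expansion fps_const s * (fps_X * A)"
    by (intro fps_expansion_intros A)
  have "eventually (\<lambda>z. z \<in> ball 0 1) (nhds (0::complex))"
    by (rule eventually_nhds_in_open) auto
  hence "eventually (\<lambda>z. (1 + z) * deriv (f_fun s) z = s * (z * f_fun s z)) (nhds 0)"
    by eventually_elim (use deriv_f_fun in auto)
  hence "(\<lambda>z. s * (z * f_fun s z)) has_fps_expansion (1 + fps_X) * fps_deriv A"
    using 1 by (subst (asm) has_fps_expansion_cong[OF _ refl]) auto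
  hence "(1 + fps_X) * fps_deriv A = fps_const s * (fps_X * A)"
    using 2 by (rule fps_expansion_unique_complex)
  hence "fps_nth ((1 + fps_X) * fps_deriv A) (Suc j) = fps_nth (fps_const s * (fps_X * A)) (Suc j)"
    by simp
  thus ?thesis
    by (simp add: nth distrib_right) (simp add: algebra_simps)
qed

text \<open>
  The Taylor coefficients of \<open>exp (q * (- z - ln (1 - z)))\<close>. They obey the recurrence of
  \<open>f_coeff\<close> with all signs positive, and therefore majorise \<open>f_coeff s\<close> for \<open>cmod s = q\<close>.
\<close>
fun maj_coeff :: "real \<Rightarrow> nat \<Rightarrow> real" where
  "maj_coeff q 0 = 1"
| "maj_coeff q (Suc 0) = 0"
| "maj_coeff q (Suc (Suc j)) = (q * maj_coeff q j + real (j + 1) * maj_coeff q (j + 1)) / real (j + 2)"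

lemma maj_coeff_nonneg: "q \<ge> 0 \<Longrightarrow> maj_coeff q j \<ge> 0"
  by (induction q j rule: maj_coeff.induct) auto

lemma norm_f_coeff_le: "cmod (f_coeff s j) \<le> maj_coeff (cmod s) j"
proof (induction "cmod s" j rule: maj_coeff.induct)
  case (3 j)
  have "real (j + 2) * cmod (f_coeff s (j + 2)) = cmod (of_nat (j + 2) * f_coeff s (j + 2))"
    by (simp only: norm_mult norm_of_nat)
  also have "\<dots> = cmod (s * f_coeff s j - of_nat (j + 1) * f_coeff s (j + 1))"
    by (simp only: f_coeff_rec)
  also have "\<dots> \<le> cmod (s * f_coeff s j) + cmod (of_nat (j + 1) * f_coeff s (j + 1))"
    by (rule norm_triangle_ineq4)
  also have "\<dots> = cmod s * cmod (f_coeff s j) + real (j + 1) * cmod (f_coeff s (j + 1))"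
    by (simp only: norm_mult norm_of_nat)
  also have "\<dots> \<le> cmod s * maj_coeff (cmod s) j + real (j + 1) * maj_coeff (cmod s) (j + 1)"
    using 3 by (intro add_mono mult_left_mono) auto
  finally show ?case by (simp add: field_simps)
qed (simp_all add: f_coeff_0 f_coeff_1)

text \<open>For s = q the alternating sign absorbs the minus sign in the recurrence. So the
  generating function of the majorant is \<open>f_fun\<close> at parameter q and argument - x, and
  its convergence and closed form come from \<open>f_fun_sums\<close>.\<close>

lemma f_coeff_of_real: "f_coeff (of_real q) j = of_real ((-1) ^ j * maj_coeff q j)"
proof (induction q j rule: maj_coeff.induct)
  case (3 q j)
  have "of_nat (j + 2) * f_coeff (of_real q) (j + 2)
          = of_real (q * ((-1) ^ j * maj_coeff q j) - real (j + 1) * ((-1) ^ (j + 1) * maj_coeff q (j + 1)))"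
    unfolding f_coeff_rec 3 by simp
  also have "q * ((-1) ^ j * maj_coeff q j) - real (j + 1) * ((-1) ^ (j + 1) * maj_coeff q (j + 1))
      = real (j + 2) * ((-1) ^ (j + 2) * maj_coeff q (j + 2))"
    by (simp add: divide_simps) (simp add: algebra_simps)
  also have "complex_of_real \<dots> = of_nat (j + 2) * of_real ((-1) ^ (j + 2) * maj_coeff q (j + 2))"
    by (simp only: of_real_mult of_real_of_nat_eq)
  finally have "of_nat (j + 2) * f_coeff (of_real q) (j + 2)
                  = of_nat (j + 2) * of_real ((-1) ^ (j + 2) * maj_coeff q (j + 2))" .
  hence "f_coeff (of_real q) (j + 2) = of_real ((-1) ^ (j + 2) * maj_coeff q (j + 2))"
    using of_nat_eq_0_iff[of "j + 2", where ?'a = complex] by (simp only: mult_cancel_left) simp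
  thus ?case by simp
qed (simp_all add: f_coeff_0 f_coeff_1)

lemma maj_coeff_sums:
  assumes "0 \<le> x" "x < 1"
  shows "(\<lambda>j. maj_coeff q j * x ^ j) sums exp (q * (- x - ln (1 - x)))"
proof -
  have "(\<lambda>j. f_coeff (of_real q) j * (- of_real x) ^ j) sums f_fun (of_real q) (- of_real x)"
    using assms by (intro f_fun_sums) auto
  also have "(\<lambda>j. f_coeff (of_real q) j * (- of_real x) ^ j)
             = (\<lambda>j. complex_of_real (maj_coeff q j * x ^ j))"
    by (rule ext) (simp add: f_coeff_of_real power_minus[of "of_real x :: complex"] flip: power_add mult_2)
  also have "f_fun (of_real q) (- of_real x) = complex_of_real (exp (q * (- x - ln (1 - x))))"
  proof -
    have "Ln (1 + - of_real x) = Ln (of_real (1 - x))" by simp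
    also have "\<dots> = of_real (ln (1 - x))" using assms by (intro Ln_of_real) auto
    finally show ?thesis unfolding f_fun_def by (simp add: algebra_simps flip: exp_of_real)
  qed
  finally show ?thesis by (simp only: sums_of_real_iff)
qed

text \<open>Rankin's trick; the constant term of the majorant drops out because \<open>n \<ge> 1\<close>.\<close>
lemma maj_coeff_tail_le:
  assumes q: "q \<ge> 0" and x: "0 \<le> x" "x \<le> \<rho>" and \<rho>: "0 < \<rho>" "\<rho> < 1" and n: "n \<ge> 1"
  shows "(\<Sum>j. maj_coeff q (j + n) * x ^ (j + n)) \<le> (x / \<rho>) ^ n * (exp (q * (- \<rho> - ln (1 - \<rho>))) - 1)"
proof -
  let ?b = "\<lambda>j. maj_coeff q j * \<rho> ^ j"
  have b0: "?b j \<ge> 0" for j using maj_coeff_nonneg[OF q, of j] \<rho> by simp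
  have S: "?b sums exp (q * (- \<rho> - ln (1 - \<rho>)))" using \<rho> by (intro maj_coeff_sums) auto
  have Sx: "summable (\<lambda>j. maj_coeff q (j + n) * x ^ (j + n))"
    using maj_coeff_sums[of x q] x \<rho> by (intro summable_ignore_initial_segment) (auto simp: sums_iff)
  have Sn: "summable (\<lambda>j. ?b (j + n))"
    using S by (intro summable_ignore_initial_segment) (auto simp: sums_iff)
  have le: "maj_coeff q (j + n) * x ^ (j + n) \<le> (x / \<rho>) ^ n * ?b (j + n)" for j
  proof -
    have "x ^ (j + n) = (x / \<rho>) ^ (j + n) * \<rho> ^ (j + n)"
      using \<rho> by (simp add: power_divide)
    also have "\<dots> \<le> (x / \<rho>) ^ n * \<rho> ^ (j + n)"
      using x \<rho> by (intro mult_right_mono power_decreasing) auto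
    finally have "maj_coeff q (j + n) * x ^ (j + n) \<le> maj_coeff q (j + n) * ((x / \<rho>) ^ n * \<rho> ^ (j + n))"
      by (intro mult_left_mono maj_coeff_nonneg q)
    thus ?thesis by (simp only: mult_ac)
  qed
  have "(\<Sum>j. maj_coeff q (j + n) * x ^ (j + n)) \<le> (\<Sum>j. (x / \<rho>) ^ n * ?b (j + n))"
    by (intro suminf_le le Sx summable_mult Sn)
  also have "\<dots> = (x / \<rho>) ^ n * (\<Sum>j. ?b (j + n))"
    by (intro suminf_mult Sn)
  also have "(\<Sum>j. ?b (j + n)) = exp (q * (- \<rho> - ln (1 - \<rho>))) - (\<Sum>j<n. ?b j)"
    using suminf_minus_initial_segment[of ?b n] S by (simp add: sums_iff)
  also have "(x / \<rho>) ^ n * \<dots> \<le> (x / \<rho>) ^ n * (exp (q * (- \<rho> - ln (1 - \<rho>))) - ?b 0)"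
    using n b0 x \<rho> by (intro mult_left_mono diff_left_mono member_le_sum) auto
  finally show ?thesis by simp
qed

section \<open>Numerical bounds for the tail of the majorant\<close>

lemma exp_ge_sum: "x \<ge> 0 \<Longrightarrow> (\<Sum>k<n. x ^ k / fact k) \<le> exp (x :: real)"
  using sum_le_suminf[OF summable_exp[of x], of "{..<n}"]
  by (simp add: exp_def divide_inverse mult.commute scaleR_conv_of_real)

text \<open>Source of the constant 0.194 in \<open>eps_bound\<close>: at radius 1/2 the exponent of
  the majorant is q (ln 2 - 1/2).\<close>

lemma ln_2_le: "ln (2 :: real) \<le> 0.694"
proof -
  have "(2::real) \<le> (\<Sum>k<7. 0.694 ^ k / fact k)"
    by (simp add: eval_nat_numeral lessThan_Suc fact_numeral)
  also have "\<dots> \<le> exp 0.694" by (rule exp_ge_sum) simp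
  finally show ?thesis using ln_mono[of 2 "exp (0.694 :: real)"] by simp
qed

text \<open>The quotient of the left side by x^2 increases with x, and at 1/2 it equals 4 ln 2 - 2 <
  0.776; hence the constant 0.78.\<close>

lemma neg_ln_le_quadratic:
  fixes x :: real
  assumes "0 \<le> x" "x \<le> 1 / 2"
  shows "- x - ln (1 - x) \<le> 0.78 * x\<^sup>2"
proof -
  define D where "D y = 0.78 * y\<^sup>2 + y + ln (1 - y)" for y :: real
  have deriv: "(D has_real_derivative y * (1.56 - 1 / (1 - y))) (at y)" if "y < 1" for y
    unfolding D_def[abs_def] using that
    by (auto intro!: derivative_eq_intros simp: field_simps power2_eq_square)
  \<comment> \<open>\<open>D\<close> increases up to \<open>14 / 39\<close> and decreases afterwards, so it is minimal at an endpoint.\<close>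
  have "D x \<ge> 0"
  proof (cases "x \<le> 14 / 39")
    case True
    have "D 0 \<le> D x"
    proof (rule DERIV_nonneg_imp_nondecreasing[of 0 x D])
      fix y assume y: "0 \<le> y" "y \<le> x"
      hence "y * (1.56 - 1 / (1 - y)) \<ge> 0"
        using True by (intro mult_nonneg_nonneg) (auto simp: field_simps)
      thus "\<exists>d. DERIV D y :> d \<and> d \<ge> 0" using deriv[of y] y assms by auto
    qed (use assms in auto)
    thus ?thesis by (simp add: D_def)
  next
    case False
    have "D x \<ge> D (1 / 2)"
    proof (rule DERIV_nonpos_imp_nonincreasing[of x "1 / 2" D])
      fix y assume y: "x \<le> y" "y \<le> 1 / 2"
      hence "y * (1.56 - 1 / (1 - y)) \<le> 0"
        using False by (intro mult_nonneg_nonpos) (auto simp: field_simps)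
      thus "\<exists>d. DERIV D y :> d \<and> d \<le> 0" using deriv[of y] y assms by auto
    qed (use assms in auto)
    moreover have "D (1 / 2) \<ge> 0"
      using ln_2_le by (simp add: D_def ln_div power2_eq_square)
    ultimately show ?thesis by simp
  qed
  thus ?thesis by (simp add: D_def)
qed

text \<open>The - 1 left by the constant term is kept because for m = 0 the bound must vanish with
  s.\<close>

lemma maj_coeff_tail_le_half:
  assumes "q \<ge> 0" "0 \<le> x" "x \<le> 1 / 2" "n \<ge> 1"
  shows "(\<Sum>j. maj_coeff q (j + n) * x ^ (j + n)) \<le> (2 * x) ^ n * (exp (0.194 * q) - 1)"
proof -
  have "(\<Sum>j. maj_coeff q (j + n) * x ^ (j + n))
          \<le> (x / (1/2)) ^ n * (exp (q * (- (1/2) - ln (1 - 1/2))) - 1)"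
    using assms by (intro maj_coeff_tail_le) auto
  also have "\<dots> \<le> (2 * x) ^ n * (exp (0.194 * q) - 1)"
  proof -
    have "q * (- (1/2) - ln (1 - 1/2)) \<le> 0.194 * q"
      using mult_right_mono[OF ln_2_le, of q] assms by (simp add: ln_div algebra_simps)
    thus ?thesis using assms by (auto intro!: mult_left_mono simp: mult.commute)
  qed
  finally show ?thesis .
qed

text \<open>With n = m + 1 the radius sqrt (n / q) suits the first branch of
  \<open>eps_bound\<close>, but \<open>neg_ln_le_quadratic\<close> limits it to 1/2, that is to q >=
  4 n. In the remaining range 4 m <= q < 4 n the radius 1/2 is used and the outcome is compared with
  the first branch.\<close>

lemma maj_coeff_tail_le_eps:
  assumes u: "u \<ge> 12" "u\<^sup>2 \<ge> cmod s"
  shows "(\<Sum>j. maj_coeff (cmod s) (j + Suc m) * (1 / u) ^ (j + Suc m)) \<le> eps_bound m s u"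
    (is "?S \<le> _")
proof -
  define q where "q = cmod s"
  define n where "n = Suc m"
  have q0: "q \<ge> 0" by (simp add: q_def)
  have n: "n \<ge> 1" "real n = real m + 1" by (auto simp: n_def)
  have half: "?S \<le> (2 / u) ^ n * (exp (0.194 * q) - 1)"
    using maj_coeff_tail_le_half[of q "1/u" n] u q0 n by (simp add: q_def n_def)
  consider "real m > q / 4" | "real m \<le> q / 4" "q \<ge> 4 * real n"
    | "real m \<le> q / 4" "q < 4 * real n" "m \<ge> 1" | "m = 0" "q < 4"
    unfolding n(2) by fastforce
  thus ?thesis
  proof cases
    case 1
    \<comment> \<open>One factor 2 / u <= 1 is given up, because the second branch has exponent m,
      not m + 1.\<close>
    have "(2 / u) ^ n * (exp (0.194 * q) - 1) \<le> (2 / u) ^ m * exp (0.194 * q)"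
      using u q0 n by (intro mult_mono power_decreasing) (auto simp: n_def)
    with half 1 show ?thesis by (simp add: eps_bound_def q_def power_divide)
  next
    case 2
    \<comment> \<open>This choice makes 0.78 q \<rho>^2 equal to 0.78 n and \<rho>^(-n) equal to (q
      / n)^(n/2). It is admissible: q >= 4 n gives \<rho> <= 1/2, and u^2 >= q gives 1 / u <=
      \<rho>.\<close>
    define \<rho> where "\<rho> = sqrt (real n / q)"
    have q: "q > 0" using 2 n by linarith
    have \<rho>2: "\<rho>\<^sup>2 = real n / q" using q by (simp add: \<rho>_def)
    have \<rho>0: "\<rho> > 0" using q n by (simp add: \<rho>_def)
    have "\<rho>\<^sup>2 \<le> (1/2)\<^sup>2" unfolding \<rho>2 using 2 q by (simp add: field_simps power2_eq_square)
    hence \<rho>h: "\<rho> \<le> 1 / 2" by (rule power2_le_imp_le) simp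
    have "(1 / u)\<^sup>2 \<le> \<rho>\<^sup>2"
    proof -
      have "1 * q \<le> real n * u\<^sup>2" using u n q by (intro mult_mono) (auto simp: q_def)
      thus ?thesis unfolding \<rho>2 using u q by (simp add: field_simps)
    qed
    hence \<rho>u: "1 / u \<le> \<rho>" by (rule power2_le_imp_le) (use \<rho>0 in simp)
    have "?S \<le> (1 / u / \<rho>) ^ n * (exp (q * (- \<rho> - ln (1 - \<rho>))) - 1)"
      unfolding q_def[symmetric] n_def[symmetric]
      using q0 u \<rho>0 \<rho>h \<rho>u n by (intro maj_coeff_tail_le) auto
    also have "\<dots> \<le> (1 / u / \<rho>) ^ n * (3.5 * exp (0.78 * real n))"
    proof (rule mult_left_mono)
      have "q * (- \<rho> - ln (1 - \<rho>)) \<le> q * (0.78 * \<rho>\<^sup>2)"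
        using q0 \<rho>0 \<rho>h by (intro mult_left_mono neg_ln_le_quadratic) auto
      also have "\<dots> = 0.78 * real n" unfolding \<rho>2 using q by simp
      finally have "exp (q * (- \<rho> - ln (1 - \<rho>))) \<le> exp (0.78 * real n)" by simp
      thus "exp (q * (- \<rho> - ln (1 - \<rho>))) - 1 \<le> 3.5 * exp (0.78 * real n)"
        using exp_gt_zero[of "0.78 * real n"] by linarith
    qed (use u \<rho>0 in auto)
    also have "(1 / u / \<rho>) ^ n = q powr (real n / 2) / real n powr (real n / 2) / u ^ n"
    proof -
      have "\<rho> ^ n = \<rho> powr real n" using \<rho>0 by (simp add: powr_realpow)
      also have "\<dots> = (real n / q) powr (real n / 2)"
        using q n by (simp add: \<rho>_def powr_powr flip: powr_half_sqrt)
      also have "\<dots> = real n powr (real n / 2) / q powr (real n / 2)"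
        using q n by (simp add: powr_divide)
      finally show ?thesis using u \<rho>0 q by (simp add: power_divide power_mult_distrib mult_ac)
    qed
    finally show ?thesis using 2 unfolding eps_bound_def q_def[symmetric]
      by (simp add: n_def mult_ac add_ac)
  next
    case 3
    have q: "q > 0" using 3 n by (simp add: n_def)
    \<comment> \<open>From q < 4 n follows 0.194 q < 0.776 n, which 0.78 n covers.\<close>
    have "(2 / u) ^ n * (exp (0.194 * q) - 1) \<le> (2 / u) ^ n * exp (0.78 * real n)"
    proof (rule mult_left_mono)
      have "exp (0.194 * q) \<le> exp (0.78 * real n)" using 3 q by simp
      thus "exp (0.194 * q) - 1 \<le> exp (0.78 * real n)" by linarith
    qed (use u in auto)
    also have "\<dots> = 1 * 2 ^ n * (exp (0.78 * real n) / u ^ n)"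
      by (simp add: power_divide)
    also have "\<dots> \<le> 3.5 * ((q / real n) powr (real n / 2)) * (exp (0.78 * real n) / u ^ n)"
    proof (rule mult_right_mono)
      \<comment> \<open>As 4 m <= q, the quotient q / n is at least 4 y, so it suffices that 3.5
        y^(n/2) >= 1. From n <= 2 m follows y^(n/2) >= exp (- n / (2 m)) >= exp (- 1), and 3.5 >
        e.\<close>
      define y where "y = 1 - 1 / real n"
      have y: "y > 0" using 3 by (simp add: y_def n_def)
      have "ln (1 / y) \<le> 1 / y - 1" using y by (intro ln_le_minus_one) auto
      also have "1 / y - 1 = 1 / real m" using 3 by (simp add: y_def n_def field_simps)
      finally have "ln y \<ge> - (1 / real m)" using y by (simp add: ln_div)
      hence "real n / 2 * ln y \<ge> real n / 2 * (- (1 / real m))" by (intro mult_left_mono) auto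
      moreover have "real n / 2 * (- (1 / real m)) \<ge> - 1" using 3 by (simp add: n_def field_simps)
      ultimately have "y powr (real n / 2) \<ge> exp (- 1)" using y by (simp add: powr_def)
      hence "3.5 * y powr (real n / 2) \<ge> 3.5 * exp (- 1)" by simp
      moreover have "3.5 * exp (- 1 :: real) \<ge> 1"
        using exp_le by (simp add: exp_minus field_simps)
      ultimately have "1 * 2 ^ n \<le> 3.5 * y powr (real n / 2) * 2 ^ n"
        by (intro mult_right_mono) auto
      also have "\<dots> = 3.5 * y powr (real n / 2) * 4 powr (real n / 2)"
      proof -
        have "(4::real) powr (real n / 2) = (2 powr 2) powr (real n / 2)" by simp
        also have "\<dots> = 2 ^ n" unfolding powr_powr by (simp add: powr_realpow)
        finally show ?thesis by simp
      qed
      also have "\<dots> = 3.5 * (y * 4) powr (real n / 2)"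
        using y by (simp add: powr_mult)
      also have "\<dots> \<le> 3.5 * (q / real n) powr (real n / 2)"
      proof -
        have "y * 4 = 4 * real m / real n" by (simp add: y_def n_def field_simps)
        also have "\<dots> \<le> q / real n" using 3 by (intro divide_right_mono) auto
        finally have "y * 4 \<le> q / real n" .
        thus ?thesis using y by (intro mult_left_mono powr_mono2) auto
      qed
      finally show "1 * 2 ^ n \<le> 3.5 * ((q / real n) powr (real n / 2))" .
    qed (use u in auto)
    also have "\<dots> = eps_bound m s u"
      using 3 q n unfolding eps_bound_def q_def[symmetric]
      by (simp add: n_def powr_divide mult_ac add_ac)
    finally show ?thesis using half by simp
  next
    case 4
    \<comment> \<open>For m = 0 the previous argument would divide by m. Here exp x - 1 <= x + x^2
      keeps a factor q, which sqrt q <= 2 trades for the sqrt q in \<open>eps_bound\<close>.\<close>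
    have "exp (0.194 * q) - 1 \<le> 0.194 * q + (0.194 * q)\<^sup>2"
      using exp_bound[of "0.194 * q"] 4 q0 by simp
    also have "\<dots> = 0.194 * q * (1 + 0.194 * q)" by (simp add: power2_eq_square algebra_simps)
    also have "\<dots> \<le> 0.194 * q * 2" using 4 q0 by (intro mult_left_mono) auto
    also have "\<dots> = 0.388 * sqrt q * sqrt q" using q0 by simp
    also have "\<dots> \<le> 0.388 * sqrt q * 2"
      using 4 q0 real_sqrt_le_mono[of q 4] by (intro mult_left_mono) auto
    finally have "(2 / u) ^ n * (exp (0.194 * q) - 1) \<le> (2 / u) ^ n * (0.776 * sqrt q)"
      using u by (intro mult_left_mono) auto
    also have "\<dots> = 1.552 * sqrt q / u" using 4 by (simp add: n_def)
    also have "\<dots> \<le> 3.5 * exp 0.78 * sqrt q / u"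
    proof -
      have "1.552 * 1 \<le> 3.5 * exp (0.78::real)" by (intro mult_mono) auto
      thus ?thesis using u q0 by (intro divide_right_mono mult_right_mono) simp_all
    qed
    also have "\<dots> = eps_bound m s u"
      using 4 q0 unfolding eps_bound_def q_def[symmetric] by (simp add: powr_half_sqrt)
    finally show ?thesis using half by simp
  qed
qed

subsection \<open>Block sums\<close>

lemma higher_deriv_g_fun:
  "(deriv ^^ j) (g_fun K) (z :: complex) = (\<Sum>k<K. of_nat k ^ j * exp (of_nat k * z))"
proof (induction j arbitrary: z)
  case 0
  show ?case by (simp add: g_fun_def)
next
  case (Suc j)
  have "(deriv ^^ j) (g_fun K) = (\<lambda>z :: complex. \<Sum>k<K. of_nat k ^ j * exp (of_nat k * z))"
    using Suc by (intro ext)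
  hence "(deriv ^^ Suc j) (g_fun K) z = deriv (\<lambda>z :: complex. \<Sum>k<K. of_nat k ^ j * exp (of_nat k * z)) z"
    by simp
  also have "\<dots> = (\<Sum>k<K. of_nat k ^ Suc j * exp (of_nat k * z))"
    by (rule DERIV_imp_deriv) (auto intro!: derivative_eq_intros sum.cong)
  finally show ?case .
qed

text \<open>With w = exp (- z) and \<rho> = |w|, |1 - w|^2 = (1 - \<rho>)^2 + 4 \<rho> sin^2 (Im z /
  2), and \<rho> >= \<rho>^2. The factor |w| is kept on the right so that it cancels in
  \<open>norm_moment_sum_le\<close>.\<close>

lemma norm_one_minus_exp_ge:
  fixes z :: complex
  assumes "Re z \<ge> 0"
  shows "cmod (1 - exp (- z)) \<ge> 2 * exp (- Re z) * \<bar>sin (Im z / 2)\<bar>"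
proof (rule power2_le_imp_le)
  define \<rho> where "\<rho> = exp (- Re z)"
  define S where "S = sin (Im z / 2)"
  have \<rho>: "0 < \<rho>" "\<rho> \<le> 1" using assms by (auto simp: \<rho>_def)
  have c: "cos (Im z) = 1 - 2 * S\<^sup>2"
    using cos_double_sin[of "Im z / 2"] by (simp add: S_def)
  have "(cmod (1 - exp (- z)))\<^sup>2 = (1 - \<rho> * cos (Im z))\<^sup>2 + (\<rho> * sin (Im z))\<^sup>2"
    by (simp add: cmod_power2 Re_exp Im_exp \<rho>_def)
  also have "\<dots> = 1 - 2 * \<rho> * cos (Im z) + \<rho>\<^sup>2 * ((cos (Im z))\<^sup>2 + (sin (Im z))\<^sup>2)"
    by algebra
  also have "\<dots> = (1 - \<rho>)\<^sup>2 + 4 * \<rho> * S\<^sup>2"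
    by (subst sin_cos_squared_add2, subst c) (simp add: power2_eq_square algebra_simps)
  also have "\<dots> \<ge> 4 * \<rho> * S\<^sup>2" by simp
  also have "4 * \<rho> * S\<^sup>2 \<ge> 4 * \<rho>\<^sup>2 * S\<^sup>2"
    using \<rho> by (intro mult_right_mono mult_left_mono) (auto simp: power2_eq_square mult_left_le)
  finally show "(2 * exp (- Re z) * \<bar>sin (Im z / 2)\<bar>)\<^sup>2 \<le> (cmod (1 - exp (- z)))\<^sup>2"
    by (simp add: \<rho>_def S_def power_mult_distrib)
qed simp

text \<open>Abel summation. Since \<open>c 0 = 0\<close> there is no constant term, so every
  remaining term contains a factor w. The increments are nonnegative and telescope to
  \<open>c n\<close>; the boundary term contributes a second \<open>c n\<close>.\<close>

lemma norm_monotone_power_sum_le: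
  fixes w :: complex and c :: "nat \<Rightarrow> real"
  assumes c: "c 0 = 0" "mono c" and w: "cmod w \<le> 1"
  shows "cmod ((1 - w) * (\<Sum>k<Suc n. of_real (c k) * w ^ k)) \<le> 2 * cmod w * c n"
proof -
  have eq: "(1 - w) * (\<Sum>k<Suc n. of_real (c k) * w ^ k) =
        (\<Sum>k<n. of_real (c (Suc k) - c k) * w ^ Suc k) - of_real (c n) * w ^ Suc n"
  proof (induction n)
    case (Suc n)
    have "(1 - w) * (\<Sum>k<Suc (Suc n). of_real (c k) * w ^ k) =
        (1 - w) * (\<Sum>k<Suc n. of_real (c k) * w ^ k) + (1 - w) * (of_real (c (Suc n)) * w ^ Suc n)"
      by (simp only: sum.lessThan_Suc[of _ "Suc n"] distrib_left)
    also have "\<dots> = (\<Sum>k<Suc n. of_real (c (Suc k) - c k) * w ^ Suc k) - of_real (c (Suc n)) * w ^ Suc (Suc n)"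
      by (subst Suc) (simp add: algebra_simps)
    finally show ?case .
  qed (simp add: c)
  have pow: "cmod w ^ Suc k \<le> cmod w" for k
    using w by (simp add: mult_left_le power_le_one)
  have c0: "c n \<ge> 0" using monoD[OF c(2), of 0 n] c(1) by simp
  have "cmod ((1 - w) * (\<Sum>k<Suc n. of_real (c k) * w ^ k))
     \<le> (\<Sum>k<n. cmod (of_real (c (Suc k) - c k) * w ^ Suc k)) + cmod (of_real (c n) * w ^ Suc n)"
    unfolding eq by (intro order.trans[OF norm_triangle_ineq4] add_right_mono norm_sum)
  also have "\<dots> = (\<Sum>k<n. (c (Suc k) - c k) * cmod w ^ Suc k) + c n * cmod w ^ Suc n"
    using monoD[OF c(2)] c0 by (simp add: norm_mult norm_power del: power_Suc of_real_diff)
  also have "\<dots> \<le> (\<Sum>k<n. (c (Suc k) - c k) * cmod w) + c n * cmod w"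
    using monoD[OF c(2)] c0 by (intro add_mono sum_mono mult_left_mono pow) auto
  also have "\<dots> = 2 * cmod w * c n"
    by (simp add: sum_distrib_right[symmetric] sum_lessThan_telescope c)
  finally show ?thesis .
qed

lemma norm_moment_sum_le:
  fixes s :: complex
  assumes s: "Re s > 0" and v: "v > 0" and u: "u > 0" and j: "j \<ge> 1"
    and K: "\<And>k. k < K \<Longrightarrow> real k / real v \<le> 1 / u"
  shows "cmod (\<Sum>k<K. exp (of_nat k * (- s / of_nat v)) * (of_nat k / of_nat v) ^ j)
           \<le> (1 / u) ^ j * min_csc (g_fun K (- Re s / real v)) (Im s / (2 * real v))"
    (is "cmod ?P \<le> _ * min_csc ?g ?x")
proof -
  have pow: "(real k / real v) ^ j \<le> (1 / u) ^ j" if "k < K" for k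
    using K[OF that] by (intro power_mono) auto
  have 1: "cmod ?P \<le> (1 / u) ^ j * ?g"
  proof -
    have "cmod ?P \<le> (\<Sum>k<K. exp (real k * (- Re s / real v)) * (real k / real v) ^ j)"
      by (intro order.trans[OF norm_sum] sum_mono) (simp add: norm_mult norm_power norm_divide)
    also have "\<dots> \<le> (\<Sum>k<K. exp (real k * (- Re s / real v)) * (1 / u) ^ j)"
      by (intro sum_mono mult_left_mono pow) auto
    also have "\<dots> = (1 / u) ^ j * ?g"
      by (simp add: g_fun_def sum_distrib_right sum_distrib_left mult.commute)
    finally show ?thesis .
  qed
  have 2: "cmod ?P \<le> (1 / u) ^ j * \<bar>1 / sin ?x\<bar>" if sin: "sin ?x \<noteq> 0"
  proof (cases K)
    \<comment> \<open>For K = 0 the sum is empty. Otherwise the last index n = K - 1 carries the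
      largest weight.\<close>
    case (Suc n)
    define z where "z = s / of_nat v"
    define w where "w = exp (- z)"
    define c where "c k = (real k / real v) ^ j" for k
    have z: "Re z > 0" "Im z / 2 = ?x" using s v by (auto simp: z_def)
    have w: "cmod w \<le> 1" using z by (simp add: w_def)
    have P: "?P = (\<Sum>k<Suc n. of_real (c k) * w ^ k)"
      unfolding Suc by (intro sum.cong refl) (simp add: c_def w_def z_def exp_of_nat_mult[symmetric] mult_ac)
    have "mono c" by (auto simp: mono_def c_def intro!: power_mono divide_right_mono)
    moreover have "c 0 = 0" using j by (simp add: c_def)
    ultimately have "cmod ((1 - w) * ?P) \<le> 2 * cmod w * c n"
      unfolding P using w by (intro norm_monotone_power_sum_le)
    moreover have "2 * cmod w * \<bar>sin ?x\<bar> \<le> cmod (1 - w)"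
      using norm_one_minus_exp_ge[of z] z by (simp add: w_def)
    hence "2 * cmod w * \<bar>sin ?x\<bar> * cmod ?P \<le> cmod (1 - w) * cmod ?P"
      by (rule mult_right_mono) simp
    \<comment> \<open>Both estimates carry the factor 2 |w|; it cancels, so the cosecant appears
      with constant 1.\<close>
    ultimately have "(2 * cmod w) * (\<bar>sin ?x\<bar> * cmod ?P) \<le> (2 * cmod w) * c n"
      by (simp add: norm_mult mult_ac)
    hence "\<bar>sin ?x\<bar> * cmod ?P \<le> c n" by (subst (asm) mult_le_cancel_left_pos) (auto simp: w_def)
    also have "c n \<le> (1 / u) ^ j" unfolding c_def by (rule pow) (simp add: Suc)
    finally have "cmod ?P \<le> (1 / u) ^ j / \<bar>sin ?x\<bar>"
      using sin by (subst pos_le_divide_eq) (simp_all only: mult.commute[of "cmod _"] zero_less_abs_iff not_False_eq_True)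
    thus ?thesis by (simp add: abs_divide)
  qed (use u in simp)
  show ?thesis using 1 2 u by (auto simp: min_csc_def min_def)
qed

text \<open>Splitting off exp (- s k / v) removes the linear term of s log (1 + k / v). The
  remaining exponent is of order |s| (k / v)^2, which stays bounded for k / v <= 1 / u0 once u0 is
  of order sqrt |s|.\<close>

lemma powr_shift:
  fixes s :: complex
  assumes v: "v > 0"
  shows "of_nat (v + k) powr (- s) = of_nat v powr (- s) *
     (exp (of_nat k * (- s / of_nat v)) * f_fun s (of_nat k / of_nat v))"
proof -
  have "(of_nat (v + k) :: complex) = of_nat v * (1 + of_nat k / of_nat v)"
    using v by (simp add: field_simps)
  hence "of_nat (v + k) powr (- s) = (of_nat v * (1 + of_nat k / of_nat v)) powr (- s)" by simp
  also have "\<dots> = of_nat v powr (- s) * (1 + of_nat k / of_nat v) powr (- s)"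
  proof (rule powr_times_real)
    show "0 \<le> Re (1 + of_nat k / of_nat v)"
      by (metis Re_complex_of_real of_nat_0_le_iff of_real_1 of_real_add of_real_divide of_real_of_nat_eq
            divide_nonneg_nonneg add_nonneg_nonneg zero_le_one)
  qed auto
  also have "(1 + of_nat k / of_nat v :: complex) powr (- s)
               = exp (of_nat k * (- s / of_nat v)) * f_fun s (of_nat k / of_nat v)"
  proof -
    have "(1 + of_nat k / of_nat v :: complex) = of_real (1 + real k / real v)" by simp
    also have "\<dots> \<noteq> 0"
      by (subst of_real_eq_0_iff) (smt (verit) divide_nonneg_nonneg of_nat_0_le_iff)
    finally show ?thesis
      unfolding f_fun_def exp_add[symmetric] powr_def by (simp add: algebra_simps)
  qed
  finally show ?thesis .
qed

lemma block_error_le: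
  fixes s :: complex
  assumes s: "Re s > 0" and v: "v > 0" and u: "u > 1"
    and K: "\<And>k. k < K \<Longrightarrow> real k / real v \<le> 1 / u"
  shows "cmod ((\<Sum>k<K. exp (of_nat k * (- s / of_nat v)) * f_fun s (of_nat k / of_nat v)) -
            (\<Sum>j\<le>m. (deriv ^^ j) (f_fun s) 0 / fact j *
               ((deriv ^^ j) (g_fun K) (- s / of_nat v) / of_nat v ^ j)))
          \<le> (\<Sum>j. maj_coeff (cmod s) (j + Suc m) * (1 / u) ^ (j + Suc m)) *
             min_csc (g_fun K (- Re s / real v)) (Im s / (2 * real v))"
    (is "cmod (?F - ?G) \<le> ?S * ?B")
proof -
  define P where "P j = (\<Sum>k<K. exp (of_nat k * (- s / of_nat v)) * (of_nat k / of_nat v) ^ j)" for j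
  have "(deriv ^^ j) (g_fun K) (- s / of_nat v) / of_nat v ^ j = P j" for j
    unfolding higher_deriv_g_fun P_def sum_divide_distrib by (simp add: power_divide mult_ac)
  hence G: "?G = (\<Sum>j<Suc m. f_coeff s j * P j)"
    by (simp add: f_coeff_def lessThan_Suc_atMost)
  \<comment> \<open>The sum over k is finite, so the Taylor series may be added termwise; u > 1
    places every k / v inside the unit disc.\<close>
  have "(\<lambda>j. \<Sum>k<K. exp (of_nat k * (- s / of_nat v)) * (f_coeff s j * (of_nat k / of_nat v) ^ j)) sums ?F"
  proof (intro sums_sum sums_mult f_fun_sums)
    fix k assume "k \<in> {..<K}"
    hence "real k / real v \<le> 1 / u" by (intro K) auto
    also have "\<dots> < 1" using u by simp
    finally show "cmod (of_nat k / of_nat v) < 1" by (simp add: norm_divide)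
  qed
  also have "(\<lambda>j. \<Sum>k<K. exp (of_nat k * (- s / of_nat v)) * (f_coeff s j * (of_nat k / of_nat v) ^ j))
               = (\<lambda>j. f_coeff s j * P j)"
    by (simp add: P_def sum_distrib_left mult_ac)
  finally have sums: "(\<lambda>j. f_coeff s (j + Suc m) * P (j + Suc m)) sums (?F - ?G)"
    unfolding G by (rule sums_split_initial_segment)
  have summ: "summable (\<lambda>j. maj_coeff (cmod s) (j + Suc m) * (1 / u) ^ (j + Suc m))"
    using maj_coeff_sums[of "1 / u" "cmod s"] u
    by (intro summable_ignore_initial_segment) (auto simp: sums_iff)
  have "cmod (?F - ?G) \<le> (\<Sum>j. maj_coeff (cmod s) (j + Suc m) * (1 / u) ^ (j + Suc m) * ?B)"
  proof (rule norm_sums_le[OF sums summable_sums])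
    show "summable (\<lambda>j. maj_coeff (cmod s) (j + Suc m) * (1 / u) ^ (j + Suc m) * ?B)"
      by (intro summable_mult2 summ)
    show "cmod (f_coeff s (j + Suc m) * P (j + Suc m))
            \<le> maj_coeff (cmod s) (j + Suc m) * (1 / u) ^ (j + Suc m) * ?B" for j
      unfolding norm_mult mult.assoc P_def using u
      by (intro mult_mono norm_f_coeff_le norm_moment_sum_le s v K) (auto simp: maj_coeff_nonneg)
  qed
  also have "\<dots> = ?S * ?B" by (intro suminf_mult2[symmetric] summ)
  finally show ?thesis .
qed

subsection \<open>The sequence of blocks\<close>

lemma block_len_ge: "real v / real u0 \<le> real (block_len u0 v)"
  unfolding block_len_def by linarith

text \<open>An integer below a ceiling is below the real number itself, so rounding the block length
  up costs nothing here.\<close>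

lemma less_block_len_imp:
  assumes "k < block_len u0 v" "u0 > 0" "v > 0"
  shows "real k / real v \<le> 1 / real u0"
proof -
  have "real k < real v / real u0"
    using assms unfolding block_len_def by linarith
  thus ?thesis using assms by (simp add: field_simps)
qed

lemma block_len_pos: "u0 > 0 \<Longrightarrow> v > 0 \<Longrightarrow> block_len u0 v > 0"
  by (simp add: block_len_def)

lemma v_seq_ge: "v_seq u0 v0 r \<ge> v0"
  by (induction r) auto

text \<open>Bounds the indices with \<open>v_seq u0 v0 r < M\<close>, so that the
  \<open>GREATEST\<close> in \<open>R_max\<close> is attained.\<close>

lemma v_seq_ge_index:
  assumes "u0 > 0" "v0 > 0"
  shows "v_seq u0 v0 r \<ge> v0 + r"
proof (induction r)
  case (Suc r)
  have "block_len u0 (v_seq u0 v0 r) > 0"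
    using assms v_seq_ge[of v0 u0 r] by (intro block_len_pos) auto
  with Suc show ?case by simp
qed simp

text \<open>Each block is at least v / u0 long; the resulting geometric growth makes the number of
  blocks logarithmic in M / v0.\<close>

lemma v_seq_growth:
  assumes "u0 > 0"
  shows "real (v_seq u0 v0 r) \<ge> real v0 * (1 + 1 / real u0) ^ r"
proof (induction r)
  case (Suc r)
  have "real v0 * (1 + 1 / real u0) ^ Suc r = real v0 * (1 + 1 / real u0) ^ r * (1 + 1 / real u0)"
    by simp
  also have "\<dots> \<le> real (v_seq u0 v0 r) * (1 + 1 / real u0)"
    using Suc by (intro mult_right_mono) auto
  also have "\<dots> = real (v_seq u0 v0 r) + real (v_seq u0 v0 r) / real u0" by (simp add: algebra_simps)
  also have "\<dots> \<le> real (v_seq u0 v0 (Suc r))" using block_len_ge[of "v_seq u0 v0 r" u0] by simp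
  finally show ?case .
qed simp

lemma R_max_bounds:
  assumes "u0 > 0" "v0 > 0" "v0 < M"
  shows "v_seq u0 v0 (R_max u0 v0 M) < M" "M \<le> v_seq u0 v0 (Suc (R_max u0 v0 M))"
proof -
  let ?P = "\<lambda>r. v_seq u0 v0 r < M"
  have R: "R_max u0 v0 M = (GREATEST r. ?P r)" using assms by (simp add: R_max_def)
  have bound: "r \<le> M" if "?P r" for r using v_seq_ge_index[OF assms(1,2), of r] that by simp
  show "?P (R_max u0 v0 M)"
    unfolding R by (rule GreatestI_nat[of ?P 0 M]) (use assms bound in auto)
  show "M \<le> v_seq u0 v0 (Suc (R_max u0 v0 M))"
  proof (rule ccontr)
    assume "\<not> ?thesis"
    hence "Suc (R_max u0 v0 M) \<le> (GREATEST r. ?P r)"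
      by (intro Greatest_le_nat[of ?P _ M]) (use bound in auto)
    thus False unfolding R by simp
  qed
qed

text \<open>By maximality M is at most the next v, so the minimum in \<open>K_seq\<close> is the
  distance to M. For M = v0 the only block is empty.\<close>

lemma v_plus_K_last:
  assumes "u0 > 0" "v0 > 0" "v0 \<le> M"
  shows "v_seq u0 v0 (R_max u0 v0 M) + K_seq u0 v0 M (R_max u0 v0 M) = M"
proof (cases "v0 < M")
  case True
  from R_max_bounds[OF assms(1,2) this] show ?thesis by (auto simp: K_seq_def min_def)
next
  case False
  with assms show ?thesis by (simp add: R_max_def K_seq_def)
qed

lemma sum_full_blocks:
  "(\<Sum>r<N. \<Sum>k<block_len u0 (v_seq u0 v0 r). h (v_seq u0 v0 r + k))
     = (\<Sum>n=v0..<v_seq u0 v0 N. h n :: 'a :: comm_monoid_add)"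
proof (induction N)
  case (Suc N)
  let ?v = "v_seq u0 v0 N"
  have "(\<Sum>k<block_len u0 ?v. h (?v + k)) = (\<Sum>n=?v..<?v + block_len u0 ?v. h n)"
    using sum.shift_bounds_nat_ivl[of h 0 ?v "block_len u0 ?v"]
    by (simp add: add_ac atLeast0LessThan)
  with Suc show ?case
    using sum.atLeastLessThan_concat[of v0 ?v "?v + block_len u0 ?v" h] v_seq_ge[of v0 u0 N] by simp
qed simp

lemma sum_blocks:
  fixes h :: "nat \<Rightarrow> 'a :: comm_monoid_add"
  assumes "u0 > 0" "v0 > 0" "v0 \<le> M"
  shows "(\<Sum>r\<le>R_max u0 v0 M. \<Sum>k<K_seq u0 v0 M r. h (v_seq u0 v0 r + k)) = (\<Sum>n=v0..<M. h n)"
proof -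
  let ?R = "R_max u0 v0 M"
  let ?v = "v_seq u0 v0 ?R"
  have "(\<Sum>k<K_seq u0 v0 M ?R. h (?v + k)) = (\<Sum>n=?v..<?v + K_seq u0 v0 M ?R. h n)"
    using sum.shift_bounds_nat_ivl[of h 0 ?v "K_seq u0 v0 M ?R"]
    by (simp add: add_ac atLeast0LessThan)
  hence last: "(\<Sum>k<K_seq u0 v0 M ?R. h (?v + k)) = (\<Sum>n=?v..<M. h n)"
    using v_plus_K_last[OF assms] by simp
  have "(\<Sum>r<?R. \<Sum>k<K_seq u0 v0 M r. h (v_seq u0 v0 r + k)) = (\<Sum>n=v0..<?v. h n)"
    unfolding sum_full_blocks[symmetric] by (intro sum.cong refl) (auto simp: K_seq_def)
  with last show ?thesis
    using sum.atLeastLessThan_concat[of v0 ?v M h] v_seq_ge[of v0 u0 ?R] v_plus_K_last[OF assms]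
    by (simp add: lessThan_Suc_atMost[symmetric])
qed

lemma R_max_less:
  assumes "u0 > 0" "v0 > 0" "v0 \<le> M"
  shows "real (R_max u0 v0 M) < 2 * real u0 * ln (real M / real v0) + 1"
proof (cases "v0 < M")
  case True
  define R where "R = R_max u0 v0 M"
  define x where "x = 1 / real u0"
  have x: "0 < x" "x \<le> 1" using assms by (auto simp: x_def)
  have "real v0 * (1 + x) ^ R < real M"
    using v_seq_growth[OF assms(1), of v0 R] R_max_bounds(1)[OF assms(1,2) True]
    by (simp add: R_def x_def)
  hence "(1 + x) ^ R < real M / real v0" using assms by (simp add: field_simps)
  hence "ln ((1 + x) ^ R) < ln (real M / real v0)"
    using x assms True by (subst ln_less_cancel_iff) auto
  hence "real R * ln (1 + x) < ln (real M / real v0)" using x by (simp add: ln_realpow)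
  \<comment> \<open>Origin of the factor 2: ln (1 + x) >= x / (1 + x) >= x / 2, as x <= 1.\<close>
  moreover have "x / 2 \<le> ln (1 + x)"
  proof -
    have "x / 2 \<le> x / (1 + x)" using x by (intro divide_left_mono) auto
    also have "\<dots> \<le> ln (1 + x)"
      using ln_le_minus_one[of "1 / (1 + x)"] x by (simp add: ln_div field_simps)
    finally show ?thesis .
  qed
  hence "real R * (x / 2) \<le> real R * ln (1 + x)" by (intro mult_left_mono) auto
  ultimately have "real R * (x / 2) < ln (real M / real v0)" by linarith
  hence "real R < 2 * real u0 * ln (real M / real v0)" using assms by (simp add: x_def field_simps)
  thus ?thesis by (simp add: R_def)
\<comment> \<open>For M = v0 both R and the logarithm are 0, and the + 1 makes the inequality
  strict.\<close>
qed (use assms in \<open>simp add: R_max_def\<close>)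

section \<open>The error term as a sum of block errors\<close>

theorem theorem1:
  fixes s :: complex and u0 v0 M m :: nat
  assumes "Re s > 0"
    and "v0 \<ge> u0"
    and "real u0 \<ge> 2 * Max {6, sqrt (conductor s), Re s}"
    and "M \<ge> v0"
  shows "zeta s = (\<Sum>n = 1..v0 - 1. 1 / of_nat n powr s)
           + (\<Sum>r\<le>R_max u0 v0 M. B_coeff u0 v0 M r s m / of_nat (v_seq u0 v0 r) powr s)
           + of_nat M powr (- s) / 2 + of_nat M powr (1 - s) / (s - 1)
           + T_rem M m s u0 v0 + zeta_rem M s
       \<and> cmod (T_rem M m s u0 v0) \<le> eps_bound m s (real u0) * B_bound M s u0 v0
       \<and> real (R_max u0 v0 M) < 2 * real u0 * ln (real M / real v0) + 1"
proof (intro conjI)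
  have u12: "real u0 \<ge> 12" and usqrt: "real u0 \<ge> 2 * sqrt (conductor s)"
    using assms(3) by auto
  have u0: "u0 > 0" "v0 > 0" using u12 assms(2) by auto
  have usq: "(real u0)\<^sup>2 \<ge> cmod s"
  proof -
    have "(2 * sqrt (conductor s))\<^sup>2 \<le> (real u0)\<^sup>2"
      using usqrt by (intro power_mono) (auto simp: conductor_def)
    thus ?thesis using norm_ge_zero[of s] by (simp add: power_mult_distrib conductor_def del: norm_ge_zero)
  qed
  let ?R = "R_max u0 v0 M" and ?v = "v_seq u0 v0" and ?K = "K_seq u0 v0 M"
  have v: "?v r > 0" for r using v_seq_ge[of v0 u0 r] u0 by simp
  define E where "E r = (\<Sum>k<?K r. exp (of_nat k * (- s / of_nat (?v r))) * f_fun s (of_nat k / of_nat (?v r)))"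
    for r
  have "(\<Sum>n=1..<M. of_nat n powr (- s)) =
          (\<Sum>n=1..<v0. of_nat n powr (- s)) + (\<Sum>n=v0..<M. of_nat n powr (- s))"
    using u0 assms(4) by (subst sum.atLeastLessThan_concat) auto
  also have "(\<Sum>n=v0..<M. of_nat n powr (- s)) = (\<Sum>r\<le>?R. of_nat (?v r) powr (- s) * E r)"
    unfolding sum_blocks[OF u0 assms(4), symmetric] E_def sum_distrib_left
    by (intro sum.cong refl powr_shift v)
  also have "(\<Sum>n=1..<v0. of_nat n powr (- s)) = (\<Sum>n = 1..v0 - 1. 1 / of_nat n powr s)"
    using u0 by (intro sum.cong) (auto simp: powr_minus divide_inverse)
  finally have S: "(\<Sum>n=1..<M. of_nat n powr (- s)) =
      (\<Sum>n = 1..v0 - 1. 1 / of_nat n powr s) + (\<Sum>r\<le>?R. of_nat (?v r) powr (- s) * E r)" .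
  have B: "B_coeff u0 v0 M r s m / of_nat (?v r) powr s = of_nat (?v r) powr (- s) * B_coeff u0 v0 M r s m"
    for r by (simp add: powr_minus divide_inverse)
  \<comment> \<open>Unfolding \<open>zeta_rem\<close> cancels zeta, the half term and the pole term,
    leaving an identity between finite sums. So s = 1 needs no separate treatment, whatever value
    \<open>zeta\<close> takes there.\<close>
  have T: "T_rem M m s u0 v0 =
      (\<Sum>r\<le>?R. of_nat (?v r) powr (- s) * (E r - B_coeff u0 v0 M r s m))"
    unfolding T_rem_def zeta_rem_def S B right_diff_distrib sum_subtractf by simp
  have K: "real k / real (?v r) \<le> 1 / real u0" if "k < ?K r" for k r
    using that u0 v by (intro less_block_len_imp) (auto simp: K_seq_def split: if_splits)
  have "cmod (T_rem M m s u0 v0)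
     \<le> (\<Sum>r\<le>?R. real (?v r) powr (- Re s) * (eps_bound m s (real u0) *
           min_csc (g_fun (?K r) (- Re s / real (?v r))) (Im s / (2 * real (?v r)))))"
    unfolding T
  proof (intro order.trans[OF norm_sum] sum_mono)
    fix r
    let ?B = "min_csc (g_fun (?K r) (- Re s / real (?v r))) (Im s / (2 * real (?v r)))"
    have "?B \<ge> 0" by (auto simp: min_csc_def g_fun_def intro!: sum_nonneg)
    have "cmod (E r - B_coeff u0 v0 M r s m)
        \<le> (\<Sum>j. maj_coeff (cmod s) (j + Suc m) * (1 / real u0) ^ (j + Suc m)) * ?B"
      unfolding E_def B_coeff_def using assms(1) v u12 K by (intro block_error_le) auto
    also have "\<dots> \<le> eps_bound m s (real u0) * ?B"
      using \<open>?B \<ge> 0\<close> u12 usq by (intro mult_right_mono maj_coeff_tail_le_eps)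
    finally have "cmod (E r - B_coeff u0 v0 M r s m) \<le> eps_bound m s (real u0) * ?B" .
    moreover have "cmod (of_nat (?v r) powr (- s)) = real (?v r) powr (- Re s)"
      using v[of r] by (subst norm_powr_real_powr) auto
    ultimately show "cmod (of_nat (?v r) powr (- s) * (E r - B_coeff u0 v0 M r s m))
        \<le> real (?v r) powr (- Re s) * (eps_bound m s (real u0) * ?B)"
      by (simp add: norm_mult mult_left_mono)
  qed
  also have "\<dots> = eps_bound m s (real u0) * B_bound M s u0 v0"
    by (simp add: B_bound_def sum_distrib_left mult_ac)
  finally show "cmod (T_rem M m s u0 v0) \<le> eps_bound m s (real u0) * B_bound M s u0 v0" .
  show "real ?R < 2 * real u0 * ln (real M / real v0) + 1"
    using u0 assms(4) by (rule R_max_less)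
\<comment> \<open>The displayed formula for zeta holds by the definition of
  \<open>T_rem\<close>.\<close>
qed (simp add: T_rem_def)

end
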